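(* Let $\lambda\in\mathbb{C}^*$, $\alpha\in\mathbb{C}$, $h(t)\in\mathbb{C}[t]$, and let $V=\mathbb{C}[t^2,s]\oplus t\,\mathbb{C}[t^2,s]$ be the $\mathbb{Z}_2$-graded vector space with $V_{\bar 0}=\mathbb{C}[t^2,s]$ and $V_{\bar 1}=t\,\mathbb{C}[t^2,s]$. For $m\in\mathbb{Z}$, $i=1,2$ and $f(t^2,s)\in\mathbb{C}[t^2,s]$ define $$L_m f(t^2,s)=\lambda^m\big(s+h_m(t^2)\big)f(t^2,s-m)-m\lambda^m(t^2-m\alpha)\frac{\partial}{\partial t^2}\big(f(t^2,s-m)\big),$$ $$L_m\, tf(t^2,s)=\lambda^m\Big(s-\frac m2+h_m(t^2)\Big)tf(t^2,s-m)-m\lambda^m(t^2-m\alpha)\,t\,\frac{\partial}{\partial t^2}f(t^2,s-m),$$ $$W_m f(t^2,s)=\lambda^m(t^2-m\alpha)f(t^2,s-m),\qquad W_m\, tf(t^2,s)=\lambda^m(t^2-m\alpha)\,tf(t^2,s-m),$$ $$G_m f(t^2,s)=\lambda^m\, tf(t^2,s-m),\qquad G_m\, tf(t^2,s)=\lambda^m(t^2-2m\alpha)f(t^2,s-m),$$ $$C_i(f(t^2,s))=C_i(tf(t^2,s))=0.$$ Then $V$ is an $\mathfrak{S}^0$-module under this action, and it is free of rank $1$ as a module over $U(\mathfrak{t})$, where $\mathfrak{t}=\mathbb{C}L_0\oplus\mathbb{C}W_0\oplus\mathbb{C}G_0$.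
   Context: All vector spaces are over $\mathbb{C}$. The Ramond type super-BMS$_3$ algebra $\mathfrak{S}^0$ is the Lie superalgebra with basis $\{L_m,W_m,G_m,C_1,C_2\mid m\in\mathbb{Z}\}$, where $L_m,W_m,C_1,C_2$ are even, the $G_m$ are odd, $C_1,C_2$ are central, and the non-trivial brackets are $$[L_m,L_n]=(n-m)L_{m+n}+\tfrac{n^3-n}{12}\delta_{m+n,0}C_1,\quad [L_m,W_n]=(n-m)W_{m+n}+\tfrac{n^3-n}{12}\delta_{m+n,0}C_2,$$ $$[L_m,G_r]=(r-\tfrac m2)G_{m+r},\quad [G_r,G_s]=2W_{r+s}+\tfrac13(r^2-\tfrac14)\delta_{r+s,0}C_2$$ (so $[W_m,W_n]=0$ and $[W_m,G_r]=0$). A module over a Lie superalgebra $\mathcal{G}$ is a $\mathbb{Z}_2$-graded vector space $V$ with a bilinear action satisfying $x(yv)-(-1)^{|x||y|}y(xv)=[x,y]v$ for homogeneous $x,y$, and $\mathcal{G}_{\bar i}V_{\bar j}\subseteq V_{\bar i+\bar j}$. For $h(t)\in\mathbb{C}[t]$, $\alpha\in\mathbb{C}$ and $m\in\mathbb{Z}$, $h_m(t)=m\,h(t)-m(m-1)\alpha\,\frac{h(t)-h(\alpha)}{t-\alpha}\in\mathbb{C}[t]$. The operator $\frac{\partial}{\partial t^2}$ is the partial derivative with respect to the variable $t^2$ on the polynomial ring $\mathbb{C}[t^2,s]$. $\mathfrak{t}$ is taken modulo the center, so $G_0^2=W_0$ and $U(\mathfrak{t})=\mathbb{C}[L_0,W_0]\oplus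 G_0\mathbb{C}[L_0,W_0]$. Being free of rank $1$ over $U(\mathfrak{t})$ means that there is a homogeneous element $v$ such that every element can be written uniquely as $p(L_0,W_0)v+G_0q(L_0,W_0)v$ with $p,q$ polynomials. *)

theory Defs
  imports Complex_Main "HOL-Library.Z2" "HOL-Library.Product_Plus" "HOL-Library.Poly_Mapping"
    "HOL-Computational_Algebra.Polynomial"
begin

section \<open>Lie superalgebras and their modules\<close>

locale z2_graded_space = vector_space scale
  for scale :: "complex \<Rightarrow> 'v::ab_group_add \<Rightarrow> 'v" +
  fixes gr :: "bit \<Rightarrow> 'v set"
  assumes gr_subspace: "subspace (gr i)"
    and gr_disjoint: "gr 0 \<inter> gr 1 = {0}"
    and gr_span: "\<exists>a\<in>gr 0. \<exists>b\<in>gr 1. v = a + b"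

definition super_sign :: "bit \<Rightarrow> bit \<Rightarrow> complex"
  where "super_sign i j = (if i = 1 \<and> j = 1 then - 1 else 1)"

locale lie_superalgebra = z2_graded_space scale gr
  for scale :: "complex \<Rightarrow> 'g::ab_group_add \<Rightarrow> 'g" and gr :: "bit \<Rightarrow> 'g set" +
  fixes br :: "'g \<Rightarrow> 'g \<Rightarrow> 'g"
  assumes br_linear_left: "Vector_Spaces.linear scale scale (\<lambda>x. br x y)"
    and br_linear_right: "Vector_Spaces.linear scale scale (br x)"
    and br_graded: "x \<in> gr i \<Longrightarrow> y \<in> gr j \<Longrightarrow> br x y \<in> gr (i + j)"
    and br_skew: "x \<in> gr i \<Longrightarrow> y \<in> gr j \<Longrightarrow> br x y = - scale (super_sign i j) (br y x)"
    and br_jacobi: "x \<in> gr i \<Longrightarrow> y \<in> gr j \<Longrightarrow> z \<in> gr k \<Longrightarrow>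
      br x (br y z) = br (br x y) z + scale (super_sign i j) (br y (br x z))"

locale lie_superalgebra_module =
  G: lie_superalgebra gscale ggr br + V: z2_graded_space vscale vgr
  for gscale :: "complex \<Rightarrow> 'g::ab_group_add \<Rightarrow> 'g" and ggr :: "bit \<Rightarrow> 'g set"
    and br :: "'g \<Rightarrow> 'g \<Rightarrow> 'g"
    and vscale :: "complex \<Rightarrow> 'v::ab_group_add \<Rightarrow> 'v" and vgr :: "bit \<Rightarrow> 'v set" +
  fixes act :: "'g \<Rightarrow> 'v \<Rightarrow> 'v"
  assumes act_linear_left: "Vector_Spaces.linear gscale vscale (\<lambda>x. act x v)"
    and act_linear_right: "Vector_Spaces.linear vscale vscale (act x)"
    and act_graded: "x \<in> ggr i \<Longrightarrow> v \<in> vgr j \<Longrightarrow> act x v \<in> vgr (i + j)"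
    and act_br: "x \<in> ggr i \<Longrightarrow> y \<in> ggr j \<Longrightarrow>
      act x (act y v) - vscale (super_sign i j) (act y (act x v)) = act (br x y) v"


section \<open>The Ramond type super-BMS\<open>\<^sub>3\<close> algebra\<close>

datatype bms_gen = L int | W int | G int | C1 | C2

text \<open>Elements are finitely supported coefficient functions on the basis.\<close>
type_synonym bms = "bms_gen \<Rightarrow>\<^sub>0 complex"

abbreviation gen :: "bms_gen \<Rightarrow> bms"
  where "gen b \<equiv> Poly_Mapping.single b 1"

definition bms_scale :: "complex \<Rightarrow> bms \<Rightarrow> bms"
  where "bms_scale c = Poly_Mapping.map ((*) c)"

fun gen_parity :: "bms_gen \<Rightarrow> bit"
  where
    "gen_parity (G r) = 1"
  | "gen_parity _ = 0"

definition bms_gr :: "bit \<Rightarrow> bms set"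
  where "bms_gr i = {x. \<forall>b\<in>Poly_Mapping.keys x. gen_parity b = i}"

definition central_term :: "int \<Rightarrow> int \<Rightarrow> bms_gen \<Rightarrow> complex \<Rightarrow> bms"
  where "central_term m n C c = (if m + n = 0 then Poly_Mapping.single C c else 0)"

fun gen_bracket :: "bms_gen \<Rightarrow> bms_gen \<Rightarrow> bms"
  where
    "gen_bracket (L m) (L n) = Poly_Mapping.single (L (m + n)) (of_int n - of_int m)
       + central_term m n C1 ((of_int n ^ 3 - of_int n) / 12)"
  | "gen_bracket (L m) (W n) = Poly_Mapping.single (W (m + n)) (of_int n - of_int m)
       + central_term m n C2 ((of_int n ^ 3 - of_int n) / 12)"
  | "gen_bracket (W n) (L m) = - (Poly_Mapping.single (W (m + n)) (of_int n - of_int m)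
       + central_term m n C2 ((of_int n ^ 3 - of_int n) / 12))"
  | "gen_bracket (L m) (G r) = Poly_Mapping.single (G (m + r)) (of_int r - of_int m / 2)"
  | "gen_bracket (G r) (L m) = - Poly_Mapping.single (G (m + r)) (of_int r - of_int m / 2)"
  | "gen_bracket (G r) (G s) = Poly_Mapping.single (W (r + s)) 2
       + central_term r s C2 (1 / 3 * (of_int r ^ 2 - 1 / 4))"
  | "gen_bracket _ _ = 0"

definition bms_bracket :: "bms \<Rightarrow> bms \<Rightarrow> bms"
  where "bms_bracket x y = (\<Sum>a\<in>Poly_Mapping.keys x. \<Sum>b\<in>Poly_Mapping.keys y.
    bms_scale (Poly_Mapping.lookup x a * Poly_Mapping.lookup y b) (gen_bracket a b))"


section \<open>Freeness of rank one over the subalgebra spanned by \<open>L\<^sub>0, W\<^sub>0, G\<^sub>0\<close>\<close>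

text \<open>\<open>p(A, B) v\<close> for commuting operators \<open>A\<close>, \<open>B\<close>: the outer variable of \<open>p\<close> is
  replaced by \<open>A\<close>, the inner one by \<open>B\<close>.\<close>
definition poly2_apply ::
    "(complex \<Rightarrow> 'v \<Rightarrow> 'v) \<Rightarrow> ('v \<Rightarrow> 'v) \<Rightarrow> ('v \<Rightarrow> 'v) \<Rightarrow> complex poly poly \<Rightarrow> 'v \<Rightarrow> 'v::ab_group_add"
  where "poly2_apply scale A B p v =
    (\<Sum>i\<le>degree p. \<Sum>j\<le>degree (coeff p i).
       scale (coeff (coeff p i) j) ((A ^^ i) ((B ^^ j) v)))"

text \<open>Modulo the centre, \<open>L\<^sub>0\<close>, \<open>W\<^sub>0\<close>, \<open>G\<^sub>0\<close> span a subalgebra in whose enveloping algebra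
  \<open>G\<^sub>0\<^sup>2 = W\<^sub>0\<close>, so each element of that algebra is uniquely
  \<open>p(L\<^sub>0, W\<^sub>0) + G\<^sub>0 q(L\<^sub>0, W\<^sub>0)\<close>.  Free of rank one means that some homogeneous \<open>v\<close> is a basis.\<close>
definition free_rank_one_t ::
    "(complex \<Rightarrow> 'v \<Rightarrow> 'v) \<Rightarrow> (bit \<Rightarrow> 'v set) \<Rightarrow> (bms \<Rightarrow> 'v \<Rightarrow> 'v::ab_group_add) \<Rightarrow> bool"
  where "free_rank_one_t scale gr act \<longleftrightarrow>
    (\<exists>v. (\<exists>i. v \<in> gr i) \<and>
      (\<forall>u. \<exists>!(p, q).
        u = poly2_apply scale (act (gen (L 0))) (act (gen (W 0))) p v
          + act (gen (G 0)) (poly2_apply scale (act (gen (L 0))) (act (gen (W 0))) q v)))"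


section \<open>The module\<close>

text \<open>A polynomial in \<open>t\<^sup>2\<close> and \<open>s\<close> is a polynomial in \<open>s\<close> (outer variable) whose
  coefficients are polynomials in \<open>t\<^sup>2\<close> (inner variable).  The pair \<open>(f, g)\<close> stands for
  \<open>f(t\<^sup>2, s) + t g(t\<^sup>2, s)\<close>.\<close>
type_synonym poly_ts = "complex poly poly"
type_synonym V = "poly_ts \<times> poly_ts"

definition V_scale :: "complex \<Rightarrow> V \<Rightarrow> V"
  where "V_scale c = map_prod (smult [:c:]) (smult [:c:])"

definition V_gr :: "bit \<Rightarrow> V set"
  where "V_gr i = (if i = 0 then UNIV \<times> {0} else {0} \<times> UNIV)"

definition var_s :: poly_ts where "var_s = [:0, 1:]"

definition const_s :: "complex poly \<Rightarrow> poly_ts" where "const_s a = [:a:]"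

definition shift_s :: "int \<Rightarrow> poly_ts \<Rightarrow> poly_ts"
  where "shift_s m f = pcompose f (var_s - of_int m)"

definition d_t2 :: "poly_ts \<Rightarrow> poly_ts"
  where "d_t2 = map_poly pderiv"

definition h_fun :: "complex poly \<Rightarrow> complex \<Rightarrow> int \<Rightarrow> complex poly"
  where "h_fun h \<alpha> m = smult (of_int m) h
    - smult (of_int m * (of_int m - 1) * \<alpha>) ((h - [:poly h \<alpha>:]) div [:- \<alpha>, 1:])"

text \<open>The element \<open>t\<^sup>2 - c\<close> of \<open>poly_ts\<close>.\<close>
definition t2_minus :: "complex \<Rightarrow> poly_ts"
  where "t2_minus c = const_s [:- c, 1:]"

fun gen_act :: "complex \<Rightarrow> complex \<Rightarrow> complex poly \<Rightarrow> bms_gen \<Rightarrow> V \<Rightarrow> V"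
  where
    "gen_act lam \<alpha> h (L m) (f, g) = V_scale (lam powi m)
      ((var_s + const_s (h_fun h \<alpha> m)) * shift_s m f
         - of_int m * t2_minus (of_int m * \<alpha>) * d_t2 (shift_s m f),
       (var_s - const_s [:of_int m / 2:] + const_s (h_fun h \<alpha> m)) * shift_s m g
         - of_int m * t2_minus (of_int m * \<alpha>) * d_t2 (shift_s m g))"
  | "gen_act lam \<alpha> h (W m) (f, g) = V_scale (lam powi m)
      (t2_minus (of_int m * \<alpha>) * shift_s m f, t2_minus (of_int m * \<alpha>) * shift_s m g)"
  | "gen_act lam \<alpha> h (G m) (f, g) = V_scale (lam powi m)
      (t2_minus (2 * of_int m * \<alpha>) * shift_s m g, shift_s m f)"
  | "gen_act lam \<alpha> h C1 (f, g) = 0"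
  | "gen_act lam \<alpha> h C2 (f, g) = 0"

definition V_act :: "complex \<Rightarrow> complex \<Rightarrow> complex poly \<Rightarrow> bms \<Rightarrow> V \<Rightarrow> V"
  where "V_act lam \<alpha> h x v =
    (\<Sum>b\<in>Poly_Mapping.keys x. V_scale (Poly_Mapping.lookup x b) (gen_act lam \<alpha> h b v))"

end

theory Submission
  imports Defs
begin

text \<open>
  Write \<open>T = t\<^sup>2\<close>, let \<open>\<sigma>\<close> be the shift \<open>f(T, s) \<mapsto> f(T, s - 1)\<close> and put
  \<open>A\<^sub>m = h\<^sub>m(T) - m (T - m \<alpha>) \<partial>/\<partial>T - m \<beta>\<close>.  Then \<open>L\<^sub>m\<close> acts as \<open>\<lambda>\<^sup>m (s + A\<^sub>m) \<sigma>\<^sup>m\<close>, with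
  \<open>\<beta> = 0\<close> on the even and \<open>\<beta> = 1/2\<close> on the odd part, \<open>W\<^sub>m\<close> acts as
  \<open>\<lambda>\<^sup>m (T - m \<alpha>) \<sigma>\<^sup>m\<close> on both, and \<open>G\<^sub>m\<close> as \<open>\<lambda>\<^sup>m \<sigma>\<^sup>m\<close> from even to odd and as
  \<open>\<lambda>\<^sup>m (T - 2 m \<alpha>) \<sigma>\<^sup>m\<close> from odd to even.  The powers of \<open>\<lambda>\<close> multiply along, because all
  brackets preserve the sum of the indices.

  Hence the module axiom for two basis elements is an identity between differential operators in
  \<open>T\<close> that follows from \<open>\<sigma> s = (s - 1) \<sigma>\<close>.  For \<open>L\<^sub>m\<close> and \<open>L\<^sub>n\<close> it says
  \<open>[A\<^sub>m, A\<^sub>n] + n A\<^sub>n - m A\<^sub>m = (n - m) A\<^bsub>m+n\<^esub>\<close>.  The terms with \<open>\<partial>/\<partial>T\<close> match by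
  computation, and those without are an identity for the family \<open>h\<^sub>m\<close> (\<open>h_fun_cocycle\<close>), which
  explains the shape of \<open>h\<^sub>m\<close>.  The other brackets with \<open>L\<^sub>m\<close> need only the Leibniz rule
  (\<open>Lop_mult_commutator\<close>, \<open>Lop_shift_commutator\<close>).

  The axioms are multilinear, so both the module axiom and the axioms of the Lie superalgebra itself
  reduce to basis elements (\<open>bms_gr_induct\<close>); for the Jacobi identity see \<open>gen_jacobi\<close>.

  Freeness holds because \<open>L\<^sub>0\<close> and \<open>W\<^sub>0\<close> act on \<open>\<complex>[T, s]\<close> as multiplication by \<open>s\<close> and
  \<open>T\<close>, and \<open>G\<^sub>0\<close> carries the even part isomorphically onto the odd part; so \<open>1\<close> is a basis.
\<close>

section \<open>Linear extension from the basis\<close>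

lemma lookup_bms_scale [simp]: "Poly_Mapping.lookup (bms_scale c x) b = c * Poly_Mapping.lookup x b"
  by (simp add: bms_scale_def Poly_Mapping.map.rep_eq when_def)

lemma bms_scale_single [simp]: "bms_scale c (Poly_Mapping.single b d) = Poly_Mapping.single b (c * d)"
  by (rule poly_mapping_eqI) (simp add: lookup_single when_def)

interpretation bms: vector_space bms_scale
  by unfold_locales (auto intro!: poly_mapping_eqI simp: lookup_add algebra_simps)

locale complex_vector_space = vector_space scale
  for scale :: "complex \<Rightarrow> 'v::ab_group_add \<Rightarrow> 'v"
begin

text \<open>The linear map that sends each basis element \<open>b\<close> of the algebra to \<open>F b\<close>.  Both the bracket
  (once in each argument) and the action have this form, so that their linearity is proved here
  once and for all.\<close>
definition extend_linearly :: "(bms_gen \<Rightarrow> 'v) \<Rightarrow> bms \<Rightarrow> 'v"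
  where "extend_linearly F x =
    (\<Sum>b\<in>Poly_Mapping.keys x. scale (Poly_Mapping.lookup x b) (F b))"

lemma extend_linearly_superset:
  assumes "finite A" "Poly_Mapping.keys x \<subseteq> A"
  shows "extend_linearly F x = (\<Sum>b\<in>A. scale (Poly_Mapping.lookup x b) (F b))"
  unfolding extend_linearly_def
  by (rule sum.mono_neutral_left) (use assms in \<open>auto simp: in_keys_iff\<close>)

lemma extend_linearly_add: "extend_linearly F (x + y) = extend_linearly F x + extend_linearly F y"
proof -
  let ?A = "Poly_Mapping.keys x \<union> Poly_Mapping.keys y"
  have "Poly_Mapping.keys (x + y) \<subseteq> ?A"
    by (rule Poly_Mapping.keys_add)
  then show ?thesis
    by (simp add: extend_linearly_superset[of ?A] lookup_add scale_left_distrib sum.distrib)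
qed

lemma extend_linearly_scale: "extend_linearly F (bms_scale c x) = scale c (extend_linearly F x)"
proof -
  have "Poly_Mapping.keys (bms_scale c x) \<subseteq> Poly_Mapping.keys x"
    by (auto simp: in_keys_iff)
  then show ?thesis
    by (simp add: extend_linearly_superset[of "Poly_Mapping.keys x"] scale_sum_right)
qed

lemma extend_linearly_single [simp]: "extend_linearly F (Poly_Mapping.single b c) = scale c (F b)"
  by (simp add: extend_linearly_def)

lemma extend_linearly_fun_add:
  "extend_linearly (\<lambda>b. F b + H b) x = extend_linearly F x + extend_linearly H x"
  by (simp add: extend_linearly_def scale_right_distrib sum.distrib)

lemma extend_linearly_fun_scale:
  "extend_linearly (\<lambda>b. scale c (F b)) x = scale c (extend_linearly F x)"
  by (simp add: extend_linearly_def scale_sum_right mult.commute)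

end

interpretation bms: complex_vector_space bms_scale ..

lemma bms_sum_singles:
  "(\<Sum>b\<in>Poly_Mapping.keys x. Poly_Mapping.single b (Poly_Mapping.lookup x b)) = (x :: bms)"
  by (rule poly_mapping_eqI) (auto simp: lookup_sum lookup_single when_def in_keys_iff sum.delta)

text \<open>A homogeneous element is a combination of basis elements of its own parity.  Since all axioms
  of a Lie superalgebra and of its modules are linear in each homogeneous argument, this induction
  reduces them to basis elements.\<close>
lemma bms_gr_induct [consumes 1, case_names zero plus]:
  assumes "x \<in> bms_gr i"
    and "P 0"
    and "\<And>b c y. gen_parity b = i \<Longrightarrow> P y \<Longrightarrow> P (bms_scale c (gen b) + y)"
  shows "P x"
proof -
  have *: "P (\<Sum>b\<in>A. Poly_Mapping.single b (Poly_Mapping.lookup x b))"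
    if "finite A" "\<forall>b\<in>A. gen_parity b = i" for A
    using that
  proof (induction A)
    case (insert b A)
    then show ?case
      using assms(3)[of b _ "Poly_Mapping.lookup x b"] by simp
  qed (use assms(2) in simp)
  have "x = (\<Sum>b\<in>Poly_Mapping.keys x. Poly_Mapping.single b (Poly_Mapping.lookup x b))"
    by (rule bms_sum_singles[symmetric])
  with *[of "Poly_Mapping.keys x"] assms(1) show ?thesis
    by (auto simp: bms_gr_def)
qed

section \<open>The Lie superalgebra\<close>

lemma bms_bracket_eq:
  "bms_bracket x y = bms.extend_linearly (\<lambda>a. bms.extend_linearly (gen_bracket a) y) x"
  by (simp add: bms_bracket_def bms.extend_linearly_def bms.scale_sum_right)

lemma bms_bracket_add_left: "bms_bracket (x + x') y = bms_bracket x y + bms_bracket x' y"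
  and bms_bracket_scale_left: "bms_bracket (bms_scale c x) y = bms_scale c (bms_bracket x y)"
  and bms_bracket_add_right: "bms_bracket x (y + y') = bms_bracket x y + bms_bracket x y'"
  and bms_bracket_scale_right: "bms_bracket x (bms_scale c y) = bms_scale c (bms_bracket x y)"
  by (simp_all add: bms_bracket_eq bms.extend_linearly_add bms.extend_linearly_scale
    bms.extend_linearly_fun_add bms.extend_linearly_fun_scale)

lemma bms_bracket_single [simp]:
  "bms_bracket (Poly_Mapping.single a c) (Poly_Mapping.single b d) = bms_scale (c * d) (gen_bracket a b)"
  by (simp add: bms_bracket_eq)

lemma bms_bracket_zero [simp]: "bms_bracket 0 y = 0" "bms_bracket x 0 = 0"
  by (simp_all add: bms_bracket_def)

lemma bms_bracket_minus_left: "bms_bracket (- x) y = - bms_bracket x y"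
  and bms_bracket_minus_right: "bms_bracket x (- y) = - bms_bracket x y"
  using bms_bracket_scale_left[of "-1" x y] bms_bracket_scale_right[of x "-1" y] by simp_all

lemma bms_bracket_diff_left: "bms_bracket (x - x') y = bms_bracket x y - bms_bracket x' y"
  and bms_bracket_diff_right: "bms_bracket x (y - y') = bms_bracket x y - bms_bracket x y'"
  using bms_bracket_add_left[of x "- x'" y] bms_bracket_add_right[of x y "- y'"]
  by (simp_all add: bms_bracket_minus_left bms_bracket_minus_right)

lemmas bms_bracket_bilinear = bms_bracket_diff_left bms_bracket_diff_right
  bms_bracket_add_left bms_bracket_add_right
  bms_bracket_minus_left bms_bracket_minus_right bms_bracket_scale_left bms_bracket_scale_right

lemma bms_gr_subspace: "bms.subspace (bms_gr i)"
  unfolding bms.subspace_def bms_gr_def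
  using Poly_Mapping.keys_add by (fastforce simp: in_keys_iff)

interpretation bms: z2_graded_space bms_scale bms_gr
proof
  show "bms_gr 0 \<inter> bms_gr 1 = {0}"
    by (auto simp: bms_gr_def)
next
  fix v :: bms
  have "\<exists>a b. a \<in> bms_gr 0 \<and> b \<in> bms_gr 1 \<and> v = a + b"
  proof -
    define part where "part i = (\<Sum>b\<in>{b \<in> Poly_Mapping.keys v. gen_parity b = i}.
      Poly_Mapping.single b (Poly_Mapping.lookup v b))" for i
    have "part i \<in> bms_gr i" for i
      unfolding part_def
      by (rule bms.subspace_sum[OF bms_gr_subspace]) (auto simp: bms_gr_def)
    moreover have "part 0 + part 1 = (\<Sum>b\<in>Poly_Mapping.keys v. Poly_Mapping.single b (Poly_Mapping.lookup v b))"
      unfolding part_def by (subst sum.union_disjoint[symmetric]) (auto intro!: sum.cong)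
    moreover have "\<dots> = v"
      by (rule bms_sum_singles)
    ultimately show ?thesis
      by metis
  qed
  then show "\<exists>a\<in>bms_gr 0. \<exists>b\<in>bms_gr 1. v = a + b"
    by blast
qed (rule bms_gr_subspace)

lemma gen_bracket_graded: "gen_bracket a b \<in> bms_gr (gen_parity a + gen_parity b)"
proof -
  have single: "Poly_Mapping.single d c \<in> bms_gr i" if "gen_parity d = i" for d c i
    using that by (auto simp: bms_gr_def)
  note closed = bms.subspace_0[OF bms_gr_subspace] bms.subspace_add[OF bms_gr_subspace]
    bms.subspace_neg[OF bms_gr_subspace] bms.subspace_diff[OF bms_gr_subspace] single
  show ?thesis
    by (cases "(a, b)" rule: gen_bracket.cases) (auto simp: central_term_def intro!: closed)
qed

lemma gen_bracket_skew:
  "gen_bracket a b = - bms_scale (super_sign (gen_parity a) (gen_parity b)) (gen_bracket b a)"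
proof (cases "\<exists>m n. a = L m \<and> b = L n \<or> a = G m \<and> b = G n")
  case True
  then obtain m n where "a = L m \<and> b = L n \<or> a = G m \<and> b = G n"
    by blast
  moreover have "m + n = 0 \<longleftrightarrow> n = - m"
    by auto
  ultimately show ?thesis
    by (auto simp: super_sign_def central_term_def add.commute minus_add_distrib single_uminus[symmetric] diff_divide_distrib)
next
  case False
  then show ?thesis
    by (cases a; cases b) (auto simp: super_sign_def)
qed

text \<open>With the Kronecker delta inside the coefficient, brackets with a central term vanish by
  simplification, without a case distinction.\<close>
lemma central_term_eq: "central_term m n C c = Poly_Mapping.single C (if m + n = 0 then c else 0)"
  by (simp add: central_term_def)

text \<open>Off the centre, both sides are multiples of one basis element, whose index is the sum of the
  three given ones, and the coefficients agree as polynomials in these indices.  The central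
  coefficients need to agree only where the indices sum to zero; there one index is eliminated and
  a polynomial identity is left, which is the cocycle identity for \<open>n\<^sup>3 - n\<close> and
  \<open>r\<^sup>2 - 1/4\<close>.\<close>
lemma gen_jacobi:
  "bms_bracket (gen a) (gen_bracket b c) = bms_bracket (gen_bracket a b) (gen c)
    + bms_scale (super_sign (gen_parity a) (gen_parity b)) (bms_bracket (gen b) (gen_bracket a c))"
proof -
  \<comment> \<open>the orientation in which the simplifier eliminates one index from \<open>m + n + p = 0\<close>\<close>
  have solve: "x + y = - z \<longleftrightarrow> y = - z - x" for x y z :: int
    by auto
  show ?thesis
    apply (cases a; cases b; cases c)
    apply (simp_all add: super_sign_def bms_bracket_bilinear central_term_eq
      bms.scale_right_distrib bms.scale_right_diff_distrib ac_simps)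
    \<comment> \<open>the brackets are now computed; what remains is compared coefficient by coefficient\<close>
    apply (simp_all add: poly_mapping_eq_iff fun_eq_iff lookup_add lookup_minus lookup_single when_def)
    apply (auto simp: add_eq_0_iff solve)
    apply (simp_all add: field_simps power2_eq_square power3_eq_cube)
    done
qed

lemma lie_superalgebra_bms: "lie_superalgebra bms_scale bms_gr bms_bracket"
proof (intro lie_superalgebra.intro lie_superalgebra_axioms.intro bms.z2_graded_space_axioms)
  show "Vector_Spaces.linear bms_scale bms_scale (\<lambda>x. bms_bracket x y)" for y
    by (simp add: Vector_Spaces.linear_iff bms_bracket_bilinear bms.vector_space_axioms)
  show "Vector_Spaces.linear bms_scale bms_scale (bms_bracket x)" for x
    by (simp add: Vector_Spaces.linear_iff bms_bracket_bilinear bms.vector_space_axioms)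
next
  fix x y :: bms and i j
  assume xy: "x \<in> bms_gr i" "y \<in> bms_gr j"
  note closed = bms.subspace_0[OF bms_gr_subspace] bms.subspace_add[OF bms_gr_subspace]
    bms.subspace_scale[OF bms_gr_subspace]
  show "bms_bracket x y \<in> bms_gr (i + j)"
    using xy(1)
  proof (induction rule: bms_gr_induct)
    case (plus a c x)
    have "bms_bracket (gen a) y \<in> bms_gr (i + j)"
      using xy(2)
    proof (induction rule: bms_gr_induct)
      case (plus b d y)
      then have "gen_bracket a b \<in> bms_gr (i + j)"
        using gen_bracket_graded[of a b] \<open>gen_parity a = i\<close> by simp
      with plus.IH show ?case
        by (simp add: bms_bracket_bilinear closed del: bms_scale_single)
    qed (simp add: closed)
    with plus.IH show ?case
      by (simp add: bms_bracket_bilinear closed del: bms_scale_single)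
  qed (simp add: closed)
  show "bms_bracket x y = - bms_scale (super_sign i j) (bms_bracket y x)"
    using xy(1)
  proof (induction rule: bms_gr_induct)
    case (plus a c x)
    have "bms_bracket (gen a) y = - bms_scale (super_sign i j) (bms_bracket y (gen a))"
      using xy(2)
    proof (induction rule: bms_gr_induct)
      case (plus b d y)
      then show ?case
        using gen_bracket_skew[of a b] \<open>gen_parity a = i\<close>
        by (simp add: bms_bracket_bilinear bms.scale_right_distrib mult.commute del: bms_scale_single)
    qed simp
    with plus.IH show ?case
      by (simp add: bms_bracket_bilinear bms.scale_right_distrib mult.commute del: bms_scale_single)
  qed simp
next
  fix x y z :: bms and i j k
  assume xyz: "x \<in> bms_gr i" "y \<in> bms_gr j" "z \<in> bms_gr k"
  let ?J = "\<lambda>x y z. bms_bracket x (bms_bracket y z) =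
    bms_bracket (bms_bracket x y) z + bms_scale (super_sign i j) (bms_bracket y (bms_bracket x z))"
  note expand = bms_bracket_bilinear bms.scale_right_distrib mult.commute add_ac
  \<comment> \<open>linear extension in the last, the middle and the first argument\<close>
  have gens: "?J (gen a) (gen b) z" if "gen_parity a = i" "gen_parity b = j" for a b
    using xyz(3)
  proof (induction rule: bms_gr_induct)
    case (plus c d z)
    then show ?case
      using gen_jacobi[of a b c] that by (simp add: expand del: bms_scale_single)
  qed simp
  have gen: "?J (gen a) y z" if "gen_parity a = i" for a
    using xyz(2)
  proof (induction rule: bms_gr_induct)
    case (plus b d y)
    then show ?case
      using gens[OF that plus.hyps] by (simp add: expand del: bms_scale_single)
  qed simp
  show "?J x y z"
    using xyz(1)
  proof (induction rule: bms_gr_induct)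
    case (plus a c x)
    then show ?case
      using gen[OF plus.hyps] by (simp add: expand del: bms_scale_single)
  qed simp
qed

section \<open>Operators on polynomials\<close>

definition cst :: "complex \<Rightarrow> poly_ts" where "cst c = [:[:c:]:]"

lemma cst_add: "cst (a + b) = cst a + cst b"
  and cst_diff: "cst (a - b) = cst a - cst b"
  and cst_uminus: "cst (- a) = - cst a"
  and cst_mult: "cst (a * b) = cst a * cst b"
  and cst_0: "cst 0 = 0"
  and cst_1: "cst 1 = 1"
  and cst_numeral: "cst (numeral n) = numeral n"
  by (simp_all add: cst_def numeral_poly one_pCons)

lemma cst_of_int: "cst (of_int n) = of_int n"
  by (simp add: cst_def of_int_poly)

lemma cst_of_int_mult: "cst (of_int n * c) = of_int n * cst c"
  by (simp add: cst_mult cst_of_int)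

lemma const_s_hom:
  "const_s (a + b) = const_s a + const_s b"
  "const_s (a - b) = const_s a - const_s b"
  "const_s (a * b) = const_s a * const_s b"
  "const_s (of_int k) = of_int k"
  by (simp_all add: const_s_def of_int_poly)

lemma t2_minus_of_int: "t2_minus (of_int m * c) = t2_minus 0 - of_int m * cst c"
  unfolding cst_of_int_mult[symmetric] by (simp add: t2_minus_def const_s_def cst_def)

lemma V_scale_eq: "V_scale c (f, g) = (cst c * f, cst c * g)"
  by (simp add: V_scale_def cst_def)

lemma shift_s_hom:
  "shift_s m (f + g) = shift_s m f + shift_s m g"
  "shift_s m (f - g) = shift_s m f - shift_s m g"
  "shift_s m (f * g) = shift_s m f * shift_s m g"
  "shift_s m (const_s a) = const_s a"
  "shift_s m (cst c) = cst c"
  "shift_s m (of_int k) = of_int k"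
  "shift_s m (t2_minus c) = t2_minus c"
  "shift_s m var_s = var_s - of_int m"
  by (simp_all add: shift_s_def pcompose_add pcompose_diff pcompose_mult const_s_def cst_def
    var_s_def pcompose_pCons t2_minus_def of_int_poly)

lemma shift_s_shift_s: "shift_s m (shift_s n f) = shift_s (n + m) f"
proof -
  have "shift_s m (shift_s n f) = pcompose f (pcompose (var_s - of_int n) (var_s - of_int m))"
    by (simp add: shift_s_def pcompose_assoc)
  also have "pcompose (var_s - of_int n) (var_s - of_int m) = var_s - of_int (n + m)"
    using shift_s_hom(2,6,8) by (simp add: shift_s_def)
  finally show ?thesis
    by (simp add: shift_s_def)
qed

lemma coeff_d_t2 [simp]: "coeff (d_t2 f) i = pderiv (coeff f i)"
  by (simp add: d_t2_def coeff_map_poly)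

lemma d_t2_pCons: "d_t2 (pCons a f) = pCons (pderiv a) (d_t2 f)"
  by (simp add: d_t2_def map_poly_pCons)

lemma d_t2_0 [simp]: "d_t2 0 = 0"
  by (simp add: d_t2_def)

lemma d_t2_add: "d_t2 (f + g) = d_t2 f + d_t2 g"
  and d_t2_diff: "d_t2 (f - g) = d_t2 f - d_t2 g"
  and d_t2_smult: "d_t2 (smult a f) = smult (pderiv a) f + smult a (d_t2 f)"
  by (simp_all add: poly_eq_iff pderiv_add pderiv_diff pderiv_mult algebra_simps)

lemma d_t2_mult: "d_t2 (f * g) = d_t2 f * g + f * d_t2 g"
  by (induction f) (simp_all add: d_t2_pCons d_t2_add d_t2_smult algebra_simps)

lemma d_t2_const:
  "d_t2 (const_s a) = const_s (pderiv a)"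
  "d_t2 (cst c) = 0"
  "d_t2 (of_int k) = 0"
  "d_t2 var_s = 0"
  "d_t2 (t2_minus c) = 1"
  by (simp_all add: const_s_def cst_def of_int_poly var_s_def t2_minus_def d_t2_pCons pderiv_pCons
    one_pCons)

lemma d_t2_shift_s: "d_t2 (shift_s m f) = shift_s m (d_t2 f)"
  by (induction f)
    (simp_all add: d_t2_pCons shift_s_def pcompose_pCons d_t2_add d_t2_diff d_t2_mult
      d_t2_const[unfolded const_s_def] d_t2_const)

lemmas d_t2_simps = d_t2_add d_t2_diff d_t2_mult d_t2_const

text \<open>The operator \<open>L\<^sub>m\<close> without the factor \<open>\<lambda>\<^sup>m\<close>, with its term \<open>m \<beta>\<close> as a parameter: it
  is \<open>L\<^sub>m\<close> on the even part for \<open>\<beta> = 0\<close> and on the odd part for \<open>\<beta> = 1/2\<close>, so one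
  computation covers both.\<close>
definition Lop ::
    "complex \<Rightarrow> complex poly \<Rightarrow> complex \<Rightarrow> int \<Rightarrow> poly_ts \<Rightarrow> poly_ts"
  where "Lop \<alpha> h \<beta> m f =
    (var_s - of_int m * cst \<beta> + const_s (h_fun h \<alpha> m)) * shift_s m f
      - of_int m * t2_minus (of_int m * \<alpha>) * d_t2 (shift_s m f)"

text \<open>This is what the commutation relation of \<open>L\<^sub>m\<close> and \<open>L\<^sub>n\<close> demands of the family \<open>h\<^sub>m\<close>,
  namely the equality of the terms of order zero.  With \<open>h = h(\<alpha>) + (t - \<alpha>) k\<close> one finds
  \<open>h\<^sub>m' = m (k + (t - m \<alpha>) k')\<close>; in this form the terms with \<open>k'\<close> cancel and the rest is a
  polynomial identity in \<open>m\<close> and \<open>n\<close>.\<close>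
lemma h_fun_cocycle:
  "of_int n * h_fun h \<alpha> n - of_int m * h_fun h \<alpha> m
    + of_int n * [:- of_int n * \<alpha>, 1:] * pderiv (h_fun h \<alpha> m)
    - of_int m * [:- of_int m * \<alpha>, 1:] * pderiv (h_fun h \<alpha> n)
    = of_int (n - m) * h_fun h \<alpha> (m + n)"
proof -
  define X :: "complex poly" where "X = [:0, 1:]"
  define A :: "complex poly" where "A = [:\<alpha>:]"
  define k where "k = (h - [:poly h \<alpha>:]) div [:- \<alpha>, 1:]"
  have "[:- \<alpha>, 1:] dvd h - [:poly h \<alpha>:]"
    by (simp add: dvd_iff_poly_eq_0)
  then have "(X - A) * k = h - [:poly h \<alpha>:]"
    unfolding k_def X_def A_def by (metis dvd_mult_div_cancel diff_pCons diff_0 diff_zero)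
  then have h: "h = [:poly h \<alpha>:] + (X - A) * k"
    by (simp add: algebra_simps)
  have "pderiv (X - A) = 1"
    by (simp add: X_def A_def pderiv_pCons one_pCons)
  then have h': "pderiv h = k + (X - A) * pderiv k"
    by (subst h) (simp add: pderiv_add pderiv_mult pderiv_pCons)
  have hm: "h_fun h \<alpha> j = of_int j * h - of_int j * (of_int j - 1) * A * k" for j
    by (simp add: h_fun_def k_def[symmetric] A_def of_int_poly algebra_simps)
  have hm': "pderiv (h_fun h \<alpha> j) = of_int j * (k + (X - of_int j * A) * pderiv k)" for j
  proof -
    have const: "pderiv (of_int i * f) = of_int i * pderiv f" "pderiv (A * f) = A * pderiv f" for i f
      by (simp_all add: of_int_poly A_def pderiv_smult)
    have "pderiv (h_fun h \<alpha> j)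
        = of_int j * pderiv h - of_int j * (of_int (j - 1) * (A * pderiv k))"
      unfolding hm const[symmetric] pderiv_diff[symmetric] by (simp add: algebra_simps)
    then show ?thesis
      unfolding h' by (simp add: algebra_simps)
  qed
  have linear: "[:- of_int j * \<alpha>, 1:] = X - of_int j * A" for j
    by (simp add: X_def A_def of_int_poly)
  show ?thesis
    unfolding linear hm' unfolding hm of_int_diff of_int_add by algebra
qed

lemma shift_s_commute:
  "shift_s n (shift_s m f) = shift_s (m + n) f" "shift_s m (shift_s n f) = shift_s (m + n) f"
  by (simp_all add: shift_s_shift_s add.commute)

text \<open>Here \<open>L\<^sub>m\<close> is \<open>(s + A\<^sub>m) \<sigma>\<^sup>m\<close>, where \<open>\<sigma>\<close> shifts \<open>s\<close> by one and \<open>A\<^sub>m\<close> is a first order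
  operator in \<open>t\<^sup>2\<close>.  As \<open>\<sigma>\<^sup>m s = (s - m) \<sigma>\<^sup>m\<close>, the claim amounts to
  \<open>[A\<^sub>m, A\<^sub>n] + n A\<^sub>n - m A\<^sub>m = (n - m) A\<^bsub>m+n\<^esub>\<close>, whose terms of order zero are the cocycle
  identity above.\<close>
lemma Lop_commutator:
  "Lop \<alpha> h \<beta> m (Lop \<alpha> h \<beta> n f) - Lop \<alpha> h \<beta> n (Lop \<alpha> h \<beta> m f)
    = of_int (n - m) * Lop \<alpha> h \<beta> (m + n) f"
proof -
  define T where "T = t2_minus 0"
  have t: "t2_minus (of_int j * \<alpha>) = T - of_int j * cst \<alpha>" for j
    by (simp add: T_def t2_minus_of_int)
  have T: "d_t2 T = 1" "shift_s j T = T" for j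
    by (simp_all add: T_def d_t2_const shift_s_hom)
  define H where "H j = const_s (h_fun h \<alpha> j)" for j
  define H' where "H' j = const_s (pderiv (h_fun h \<alpha> j))" for j
  have H: "d_t2 (H j) = H' j" "shift_s i (H j) = H j" for i j
    by (simp_all add: H_def H'_def d_t2_const shift_s_hom)
  have cocycle: "of_int n * H n - of_int m * H m
      + of_int n * (T - of_int n * cst \<alpha>) * H' m - of_int m * (T - of_int m * cst \<alpha>) * H' n
      = (of_int n - of_int m) * H (m + n)"
    using arg_cong[OF h_fun_cocycle[of n h \<alpha> m], of const_s]
    unfolding const_s_hom H_def H'_def t[symmetric] t2_minus_def
    by (simp only: mult_minus_left of_int_diff)
  \<comment> \<open>moves all shifts to the right and all derivatives onto \<open>f\<close>; a polynomial identity remains\<close>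
  show ?thesis
    unfolding Lop_def t H_def[symmetric]
    apply (simp only: shift_s_hom d_t2_simps H T shift_s_commute[where n = n and m = m]
      d_t2_shift_s of_int_add of_int_diff)
    using cocycle by algebra
qed

lemma Lop_add: "Lop \<alpha> h \<beta> m (f + g) = Lop \<alpha> h \<beta> m f + Lop \<alpha> h \<beta> m g"
  by (simp add: Lop_def shift_s_hom d_t2_add algebra_simps)

lemma Lop_cst: "Lop \<alpha> h \<beta> m (cst c * f) = cst c * Lop \<alpha> h \<beta> m f"
  by (simp add: Lop_def shift_s_hom d_t2_simps algebra_simps)

text \<open>For \<open>\<gamma> = \<beta>\<close> this gives \<open>[L\<^sub>m, W\<^sub>n]\<close>.  Different values of \<open>\<beta>\<close> and \<open>\<gamma>\<close> occur in
  \<open>[L\<^sub>m, G\<^sub>n]\<close>, because \<open>G\<^sub>n\<close> exchanges the parities: this lemma covers \<open>G\<^sub>n\<close> on the odd part,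
  the next one \<open>G\<^sub>n\<close> on the even part.\<close>
lemma Lop_mult_commutator:
  "Lop \<alpha> h \<gamma> m (t2_minus c * shift_s n f) - t2_minus c * shift_s n (Lop \<alpha> h \<beta> m f)
    = ((of_int n + of_int m * cst (\<beta> - \<gamma>)) * t2_minus c - of_int m * t2_minus (of_int m * \<alpha>))
      * shift_s (m + n) f"
  unfolding Lop_def
  by (simp add: shift_s_hom d_t2_simps shift_s_commute[where n = n and m = m]
    d_t2_shift_s cst_diff algebra_simps)

lemma Lop_shift_commutator:
  "Lop \<alpha> h \<gamma> m (shift_s n f) - shift_s n (Lop \<alpha> h \<beta> m f)
    = (of_int n + of_int m * cst (\<beta> - \<gamma>)) * shift_s (m + n) f"
  unfolding Lop_def
  by (simp add: shift_s_hom d_t2_simps shift_s_commute[where n = n and m = m]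
    d_t2_shift_s cst_diff algebra_simps)

section \<open>The module\<close>

interpretation V: complex_vector_space V_scale
  by unfold_locales
    (auto simp: V_scale_eq cst_add cst_mult cst_1 algebra_simps)

interpretation V: z2_graded_space V_scale V_gr
proof
  show "V.subspace (V_gr i)" for i
    unfolding V.subspace_def V_gr_def by (auto simp: V_scale_def zero_prod_def)
  show "V_gr 0 \<inter> V_gr 1 = {0}"
    by (auto simp: V_gr_def zero_prod_def)
  show "\<exists>a\<in>V_gr 0. \<exists>b\<in>V_gr 1. v = a + b" for v
  proof (intro bexI)
    show "v = (fst v, 0) + (0, snd v)"
      by simp
  qed (auto simp: V_gr_def)
qed

text \<open>A normal form of the action in terms of \<open>Lop\<close>.  The constant \<open>2 m \<alpha>\<close> of \<open>G\<^sub>m\<close> is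
  written as an integer times a scalar, so that \<open>t2_minus_of_int\<close> applies to it as well.\<close>
lemma gen_act_simps:
  "gen_act lam \<alpha> h (L m) (f, g) =
    (cst (lam powi m) * Lop \<alpha> h 0 m f, cst (lam powi m) * Lop \<alpha> h (1 / 2) m g)"
  "gen_act lam \<alpha> h (W m) (f, g) =
    (cst (lam powi m) * (t2_minus (of_int m * \<alpha>) * shift_s m f),
     cst (lam powi m) * (t2_minus (of_int m * \<alpha>) * shift_s m g))"
  "gen_act lam \<alpha> h (G m) (f, g) =
    (cst (lam powi m) * (t2_minus (of_int m * (2 * \<alpha>)) * shift_s m g),
     cst (lam powi m) * shift_s m f)"
proof -
  have "const_s [:of_int m / 2:] = of_int m * cst (1 / 2)"
    using cst_of_int_mult[of m "1 / 2"] by (simp add: const_s_def cst_def)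
  then show "gen_act lam \<alpha> h (L m) (f, g) =
    (cst (lam powi m) * Lop \<alpha> h 0 m f, cst (lam powi m) * Lop \<alpha> h (1 / 2) m g)"
    by (simp add: V_scale_eq Lop_def cst_0)
qed (simp_all add: V_scale_eq mult_ac)

lemma gen_act_add: "gen_act lam \<alpha> h b (u + v) = gen_act lam \<alpha> h b u + gen_act lam \<alpha> h b v"
  by (cases u; cases v; cases b)
    (simp_all del: gen_act.simps(1-3) add: gen_act_simps Lop_add shift_s_hom algebra_simps)

lemma gen_act_scale: "gen_act lam \<alpha> h b (V_scale c v) = V_scale c (gen_act lam \<alpha> h b v)"
  by (cases v; cases b)
    (simp_all del: gen_act.simps(1-3) add: gen_act_simps V_scale_eq Lop_cst shift_s_hom mult.left_commute)

lemma gen_act_central: "gen_act lam \<alpha> h C1 v = 0" "gen_act lam \<alpha> h C2 v = 0"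
  by (cases v; simp)+

lemma gen_act_zero [simp]: "gen_act lam \<alpha> h b 0 = 0"
  using gen_act_scale[of lam \<alpha> h b 0 0] by simp

lemma V_act_eq: "V_act lam \<alpha> h x v = V.extend_linearly (\<lambda>b. gen_act lam \<alpha> h b v) x"
  by (simp add: V_act_def V.extend_linearly_def)

lemma V_act_single [simp]:
  "V_act lam \<alpha> h (Poly_Mapping.single b c) v = V_scale c (gen_act lam \<alpha> h b v)"
  by (simp add: V_act_eq)

lemma V_act_0 [simp]: "V_act lam \<alpha> h 0 v = 0" "V_act lam \<alpha> h x 0 = 0"
  by (simp_all add: V_act_eq V.extend_linearly_def)

lemma V_act_add_left: "V_act lam \<alpha> h (x + y) v = V_act lam \<alpha> h x v + V_act lam \<alpha> h y v"
  and V_act_scale_left: "V_act lam \<alpha> h (bms_scale c x) v = V_scale c (V_act lam \<alpha> h x v)"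
  and V_act_add_right: "V_act lam \<alpha> h x (u + v) = V_act lam \<alpha> h x u + V_act lam \<alpha> h x v"
  and V_act_scale_right: "V_act lam \<alpha> h x (V_scale c v) = V_scale c (V_act lam \<alpha> h x v)"
  by (simp_all add: V_act_eq gen_act_add gen_act_scale V.extend_linearly_add V.extend_linearly_scale
    V.extend_linearly_fun_add V.extend_linearly_fun_scale)

lemma V_act_minus_left: "V_act lam \<alpha> h (- x) v = - V_act lam \<alpha> h x v"
  using V_act_scale_left[of lam \<alpha> h "-1" x v] by simp

lemmas V_act_bilinear = V_act_add_left V_act_scale_left V_act_add_right V_act_scale_right
  V_act_minus_left

lemma V_act_central_term [simp]:
  "V_act lam \<alpha> h (central_term m n C1 c) v = 0" "V_act lam \<alpha> h (central_term m n C2 c) v = 0"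
  by (simp_all add: central_term_def gen_act_central)

lemma super_sign_commute: "super_sign i j = super_sign j i"
  and super_sign_square: "super_sign i j * super_sign i j = 1"
  by (auto simp: super_sign_def)

text \<open>By the super skew-symmetry of the bracket, the module axiom for \<open>(a, b)\<close> implies the one for
  \<open>(b, a)\<close>; this leaves one order of each pair of types of basis elements to check.\<close>
lemma gen_act_relation_swap:
  assumes "gen_act lam \<alpha> h a (gen_act lam \<alpha> h b v)
      - V_scale (super_sign (gen_parity a) (gen_parity b)) (gen_act lam \<alpha> h b (gen_act lam \<alpha> h a v))
    = V_act lam \<alpha> h (gen_bracket a b) v"
  shows "gen_act lam \<alpha> h b (gen_act lam \<alpha> h a v)
      - V_scale (super_sign (gen_parity b) (gen_parity a)) (gen_act lam \<alpha> h a (gen_act lam \<alpha> h b v))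
    = V_act lam \<alpha> h (gen_bracket b a) v"
proof -
  let ?s = "super_sign (gen_parity b) (gen_parity a)"
  have "V_act lam \<alpha> h (gen_bracket b a) v = - V_scale ?s (V_act lam \<alpha> h (gen_bracket a b) v)"
    by (subst gen_bracket_skew) (simp add: V_act_bilinear)
  then show ?thesis
    unfolding assms[symmetric] super_sign_commute[of "gen_parity a"]
    by (simp add: V.scale_right_diff_distrib super_sign_square)
qed

lemma gen_act_relation_cases:
  fixes lam \<alpha> :: complex and h :: "complex poly"
  assumes "lam \<noteq> 0"
  defines "rel \<equiv> \<lambda>a b. \<forall>v. gen_act lam \<alpha> h a (gen_act lam \<alpha> h b v)
      - V_scale (super_sign (gen_parity a) (gen_parity b)) (gen_act lam \<alpha> h b (gen_act lam \<alpha> h a v))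
    = V_act lam \<alpha> h (gen_bracket a b) v"
  shows "rel (L m) (L n)" "rel (L m) (W n)" "rel (L m) (G n)"
    "rel (W m) (W n)" "rel (W m) (G n)" "rel (G m) (G n)" "rel a C1" "rel a C2"
proof -
  have powi: "cst (lam powi m) * cst (lam powi n) = cst (lam powi (m + n))" for m n
    using assms(1) by (simp add: power_int_add cst_mult)
  \<comment> \<open>all operators commute with scalars, so the powers of \<open>\<lambda>\<close> can be collected in front\<close>
  have "cst (lam powi i) * Lop \<alpha> h \<beta> i (cst (lam powi j) * f)
        = cst (lam powi (i + j)) * Lop \<alpha> h \<beta> i f"
    and "cst (lam powi i) * shift_s i (cst (lam powi j) * f)
        = cst (lam powi (i + j)) * shift_s i f"
    and "cst (lam powi i) * (t2_minus d * shift_s i (cst (lam powi j) * f))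
        = cst (lam powi (i + j)) * (t2_minus d * shift_s i f)"
    for i j \<beta> d f
    by (simp_all add: Lop_cst shift_s_hom powi[symmetric] mult.assoc mult.left_commute)
  note act = gen_act_simps V_scale_eq this V_act_bilinear add.commute[of n m] super_sign_def
  note factor = right_diff_distrib[symmetric]
  define c where "c = cst (1 / 2)"
  have half: "c * 2 = 1"
    using cst_mult[of "1 / 2" 2] by (simp add: c_def cst_numeral cst_1)
  have half_m: "cst (of_int m / 2) = of_int m * c" for m
    using cst_of_int_mult[of m "1 / 2"] by (simp add: c_def)
  have "t2_minus ((of_int m + of_int n) * d) = t2_minus 0 - (of_int m + of_int n) * cst d" for d
    using t2_minus_of_int[of "m + n" d] by simp
  \<comment> \<open>writes all coefficients as polynomials in \<open>m\<close>, \<open>n\<close>, \<open>t\<^sup>2\<close>, \<open>\<alpha>\<close> and one half\<close>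
  note coeffs = this c_def[symmetric] t2_minus_of_int half_m cst_diff cst_of_int cst_uminus cst_0
    cst_mult cst_numeral
  show "rel (L m) (L n)"
    unfolding rel_def
    apply (clarsimp simp del: gen_act.simps(1-3) simp: act)
    apply (simp only: factor Lop_commutator)
    apply (simp add: cst_diff cst_of_int mult_ac)
    done
  show "rel (L m) (W n)"
    unfolding rel_def
    apply (clarsimp simp del: gen_act.simps(1-3) simp: act)
    apply (simp only: factor Lop_mult_commutator)
    apply (simp only: coeffs)
    apply (intro conjI allI; algebra)
    done
  show "rel (L m) (G n)"
    unfolding rel_def
    apply (clarsimp simp del: gen_act.simps(1-3) simp: act)
    apply (simp only: factor Lop_mult_commutator Lop_shift_commutator)
    apply (simp only: coeffs)
    apply (intro conjI allI)
    subgoal using half by algebra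
    subgoal by (simp add: algebra_simps)
    done
  show "rel (W m) (W n)"
    unfolding rel_def
    by (clarsimp simp del: gen_act.simps(1-3) simp: act shift_s_hom shift_s_shift_s mult_ac)
  show "rel (W m) (G n)"
    unfolding rel_def
    by (clarsimp simp del: gen_act.simps(1-3) simp: act shift_s_hom shift_s_shift_s mult_ac)
  show "rel (G m) (G n)"
    unfolding rel_def
    apply (clarsimp simp del: gen_act.simps(1-3) simp: act shift_s_hom shift_s_shift_s)
    apply (simp only: coeffs powi[symmetric])
    apply (intro conjI allI; algebra)
    done
  show "rel a C1" "rel a C2"
    unfolding rel_def by (cases a; simp add: gen_act_central)+
qed

lemma gen_act_relation:
  assumes "lam \<noteq> 0"
  shows "gen_act lam \<alpha> h a (gen_act lam \<alpha> h b v)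
      - V_scale (super_sign (gen_parity a) (gen_parity b)) (gen_act lam \<alpha> h b (gen_act lam \<alpha> h a v))
    = V_act lam \<alpha> h (gen_bracket a b) v"
proof -
  note rels = gen_act_relation_cases[OF assms, of \<alpha> h, rule_format]
  show ?thesis
    by (cases a; cases b; hypsubst) (rule rels rels[THEN gen_act_relation_swap])+
qed

lemma V_act_relation:
  assumes "lam \<noteq> 0" "x \<in> bms_gr i" "y \<in> bms_gr j"
  shows "V_act lam \<alpha> h x (V_act lam \<alpha> h y v) - V_scale (super_sign i j) (V_act lam \<alpha> h y (V_act lam \<alpha> h x v))
    = V_act lam \<alpha> h (bms_bracket x y) v"
  using assms(2)
proof (induction rule: bms_gr_induct)
  case (plus a c x)
  have "gen_act lam \<alpha> h a (V_act lam \<alpha> h y v) - V_scale (super_sign i j) (V_act lam \<alpha> h y (gen_act lam \<alpha> h a v))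
    = V_act lam \<alpha> h (bms_bracket (gen a) y) v"
    using assms(3)
  proof (induction rule: bms_gr_induct)
    case zero
    then show ?case
      by simp
  next
    case (plus b d y)
    show ?case
      using gen_act_relation[OF assms(1), of \<alpha> h a b v, symmetric] plus.hyps \<open>gen_parity a = i\<close>
      by (simp add: V_act_bilinear bms_bracket_bilinear plus.IH[symmetric] gen_act_add gen_act_scale
        V.scale_right_distrib V.scale_right_diff_distrib mult.commute del: bms_scale_single)
  qed
  note gen = this
  show ?case
    by (simp add: V_act_bilinear bms_bracket_bilinear plus.IH[symmetric] gen[symmetric]
      V.scale_right_distrib V.scale_right_diff_distrib mult.commute del: bms_scale_single)
qed simp

lemma gen_act_graded: "v \<in> V_gr j \<Longrightarrow> gen_act lam \<alpha> h b v \<in> V_gr (gen_parity b + j)"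
  by (cases v; cases b) (auto simp: V_gr_def V_scale_def shift_s_def zero_prod_def split: if_splits)

lemma lie_superalgebra_module_V:
  assumes "lam \<noteq> 0"
  shows "lie_superalgebra_module bms_scale bms_gr bms_bracket V_scale V_gr (V_act lam \<alpha> h)"
proof (intro lie_superalgebra_module.intro lie_superalgebra_module_axioms.intro
    lie_superalgebra_bms V.z2_graded_space_axioms)
  show "Vector_Spaces.linear bms_scale V_scale (\<lambda>x. V_act lam \<alpha> h x v)" for v
    by (simp add: Vector_Spaces.linear_iff V_act_bilinear bms.vector_space_axioms V.vector_space_axioms)
  show "Vector_Spaces.linear V_scale V_scale (V_act lam \<alpha> h x)" for x
    by (simp add: Vector_Spaces.linear_iff V_act_bilinear bms.vector_space_axioms V.vector_space_axioms)
next
  fix x v i j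
  assume "x \<in> bms_gr i" and v: "v \<in> V_gr j"
  then show "V_act lam \<alpha> h x v \<in> V_gr (i + j)"
  proof (induction rule: bms_gr_induct)
    case (plus b c x)
    then show ?case
      using gen_act_graded[OF v, of lam \<alpha> h b]
      by (simp add: V_act_bilinear V.subspace_add[OF V.gr_subspace] V.subspace_scale[OF V.gr_subspace]
          del: bms_scale_single)
  qed (simp add: V.subspace_0[OF V.gr_subspace])
qed (rule V_act_relation[OF assms])

section \<open>Freeness\<close>

lemma shift_s_0: "shift_s 0 f = f"
  by (simp add: shift_s_def var_s_def pcompose_idR)

lemma t_act:
  "V_act lam \<alpha> h (gen (L 0)) (f, g) = (var_s * f, var_s * g)"
  "V_act lam \<alpha> h (gen (W 0)) (f, g) = (t2_minus 0 * f, t2_minus 0 * g)"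
  "V_act lam \<alpha> h (gen (G 0)) (f, g) = (t2_minus 0 * g, f)"
  by (simp_all add: shift_s_0 h_fun_def const_s_def)

text \<open>On the even part, \<open>L\<^sub>0\<close> and \<open>W\<^sub>0\<close> are multiplication by \<open>s\<close> and \<open>t\<^sup>2\<close>, so applying
  \<open>p(L\<^sub>0, W\<^sub>0)\<close> to the constant polynomial \<open>1\<close> reproduces \<open>p\<close>.\<close>
lemma poly2_apply_unit:
  "poly2_apply V_scale (V_act lam \<alpha> h (gen (L 0))) (V_act lam \<alpha> h (gen (W 0))) p (1, 0) = (p, 0)"
proof -
  let ?A = "V_act lam \<alpha> h (gen (L 0))" and ?B = "V_act lam \<alpha> h (gen (W 0))"
  have B: "(?B ^^ j) (1, 0) = (const_s (monom 1 j), 0)" for j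
    by (induction j) (simp_all del: V_act_single add: t_act t2_minus_def const_s_def monom_Suc one_pCons)
  have A: "(?A ^^ i) (const_s a, 0) = (monom a i, 0)" for i a
    by (induction i) (simp_all del: V_act_single add: t_act var_s_def const_s_def monom_Suc monom_0)
  have "poly2_apply V_scale ?A ?B p (1, 0)
    = (\<Sum>i\<le>degree p. \<Sum>j\<le>degree (coeff p i). (monom (monom (coeff (coeff p i) j) j) i, 0))"
    by (simp add: poly2_apply_def A B V_scale_def smult_monom)
  also have "\<dots> = (\<Sum>i\<le>degree p. monom (\<Sum>j\<le>degree (coeff p i). monom (coeff (coeff p i) j) j) i, 0)"
    by (simp add: sum_prod monom_sum)
  also have "\<dots> = (p, 0)"
    by (simp add: poly_as_sum_of_monoms)
  finally show ?thesis .
qed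

text \<open>The generator is \<open>1\<close>: since \<open>G\<^sub>0 f = t f\<close>, the element \<open>f + t g\<close> is
  \<open>f(L\<^sub>0, W\<^sub>0) 1 + G\<^sub>0 g(L\<^sub>0, W\<^sub>0) 1\<close>, and \<open>f\<close>, \<open>g\<close> are determined by it.\<close>
lemma free_rank_one_t_V: "free_rank_one_t V_scale V_gr (V_act lam \<alpha> h)"
  unfolding free_rank_one_t_def
proof (intro exI conjI allI)
  show "(1, 0) \<in> V_gr 0"
    by (simp add: V_gr_def)
  show "\<exists>!(p, q). u = poly2_apply V_scale (V_act lam \<alpha> h (gen (L 0))) (V_act lam \<alpha> h (gen (W 0))) p (1, 0)
    + V_act lam \<alpha> h (gen (G 0))
      (poly2_apply V_scale (V_act lam \<alpha> h (gen (L 0))) (V_act lam \<alpha> h (gen (W 0))) q (1, 0))" for u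
    unfolding poly2_apply_unit t_act by (cases u) auto
qed

theorem proposition2p3:
  fixes lam \<alpha> :: complex and h :: "complex poly"
  assumes "lam \<noteq> 0"
  shows "lie_superalgebra_module bms_scale bms_gr bms_bracket V_scale V_gr (V_act lam \<alpha> h)
    \<and> free_rank_one_t V_scale V_gr (V_act lam \<alpha> h)"
  using lie_superalgebra_module_V[OF assms] free_rank_one_t_V by blast

end
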